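(* Let $(X,\tau)$ be a locally solid Riesz space, $F$ a Riesz algebra, and $T:X\to F$ a positive quasi $\mathbb{mo}$-$KB$ operator. Then every operator $S:X\to F$ satisfying $0\le S\le T$ is also a quasi $\mathbb{mo}$-$KB$ operator. The same holds with "quasi $\mathbb{mo}$-$KB$" replaced throughout by "quasi $\mathbb{m}_l\mathbb{o}$-$KB$", and with "quasi $\mathbb{mo}$-$KB$" replaced throughout by "quasi $\mathbb{m}_r\mathbb{o}$-$KB$".
   Context: All vector spaces are real and all operators are linear. A Riesz algebra is a Riesz space $F$ that is an associative algebra with $x\cdot y\in F_+$ whenever $x,y\in F_+$. Order convergence: a net $x_\alpha\xrightarrow{\mathbb{o}}x$ in a Riesz space if there is a net $y_\beta\downarrow 0$ such that for every $\beta$ there is $\alpha_\beta$ with $|x_\alpha-x|\le y_\beta$ for all $\alpha\ge\alpha_\beta$. In a Riesz algebra $F$: $x_\alpha\xrightarrow{\mathbb{m}_l\mathbb{o}}x$ means $u\cdot|x_\alpha-x|\xrightarrow{\mathbb{o}}0$ for all $u\in F_+$; $x_\alpha\xrightarrow{\mathbb{m}_r\mathbb{o}}x$ means $|x_\alpha-x|\cdot u\xrightarrow{\mathbb{o}}0$ for all $u\in F_+$; $x_\alpha\xrightarrow{\mathbb{m}\mathbb{o}}x$ means both hold. For $\mathbb{c}\in\{\mathbb{mo},\mathbb{m}_l\mathbb{o},\mathbb{m}_r\mathbb{o}\}$, a net $(y_\alpha)_{\alpha\in A}$ in $F$ is $\mathbb{c}$-Cauchy if the net $(y_{\alpha_1}-y_{\alpha_2})_{(\alpha_1,\alpha_2)\in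 A\times A}$ $\mathbb{c}$-converges to $0$. An operator $T:X\to F$ is quasi $\mathbb{mo}$-$KB$ (respectively quasi $\mathbb{m}_l\mathbb{o}$-$KB$, quasi $\mathbb{m}_r\mathbb{o}$-$KB$) if for every $\tau$-bounded increasing net $x_\alpha$ in $X_+$ the net $Tx_\alpha$ is $\mathbb{mo}$-Cauchy (respectively $\mathbb{m}_l\mathbb{o}$-Cauchy, $\mathbb{m}_r\mathbb{o}$-Cauchy) in $F$. $R\le Q$ for operators means $Q-R$ is positive. *)

theory Defs
  imports "HOL-Analysis.Analysis" "HOL-Library.Lattice_Algebras"
begin

section \<open>Riesz spaces and Riesz algebras\<close>

class riesz_space = ordered_real_vector + lattice_ab_group_add_abs

class riesz_algebra = real_algebra + riesz_space +
  assumes mult_pos_cone: "0 \<le> x \<Longrightarrow> 0 \<le> y \<Longrightarrow> 0 \<le> x * y"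
begin

subclass lattice_ring
proof
  fix a b c :: 'a
  assume "a \<le> b" "0 \<le> c"
  then have "0 \<le> c * (b - a)" "0 \<le> (b - a) * c"
    by (auto intro!: mult_pos_cone)
  then show "c * a \<le> c * b" "a * c \<le> b * c"
    by (auto simp: algebra_simps)
qed

end


section \<open>Locally solid Riesz spaces\<close>

class topological_real_vector = topological_ab_group_add + real_vector +
  assumes tendsto_scaleR_Pair:
    "LIM p (nhds r \<times>\<^sub>F nhds x). fst p *\<^sub>R snd p :> nhds (r *\<^sub>R x)"

definition solid :: "'a::riesz_space set \<Rightarrow> bool" where
  "solid U \<longleftrightarrow> (\<forall>x y. y \<in> U \<and> \<bar>x\<bar> \<le> \<bar>y\<bar> \<longrightarrow> x \<in> U)"

text \<open>The topology is not assumed to be Hausdorff. The members of the base of solid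
  neighbourhoods of zero need not be open.\<close>

class locally_solid_riesz_space = riesz_space + topological_real_vector +
  assumes solid_neighbourhood_base:
    "open U \<Longrightarrow> 0 \<in> U \<Longrightarrow>
      \<exists>V. V \<subseteq> U \<and> (\<exists>W. open W \<and> 0 \<in> W \<and> W \<subseteq> V) \<and>
          (\<forall>x y. y \<in> V \<and> \<bar>x\<bar> \<le> \<bar>y\<bar> \<longrightarrow> x \<in> V)"

lemma solid_neighbourhood_base':
  fixes U :: "'a::locally_solid_riesz_space set"
  assumes "open U" "0 \<in> U"
  shows "\<exists>V\<subseteq>U. 0 \<in> interior V \<and> solid V"
  using solid_neighbourhood_base[OF assms] unfolding solid_def interior_def by blast

text \<open>The library constant \<open>bounded\<close> is metric boundedness; the following is boundedness
  in a topological vector space.\<close>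

definition tau_bounded :: "'a::topological_real_vector set \<Rightarrow> bool" where
  "tau_bounded B \<longleftrightarrow>
    (\<forall>U. open U \<and> 0 \<in> U \<longrightarrow> (\<exists>c>0. (\<lambda>x. c *\<^sub>R x) ` B \<subseteq> U))"


section \<open>Nets and their convergence\<close>

text \<open>A net is a function on a directed set \<open>A\<close>, preordered by \<open>le\<close>.\<close>

definition directed_set :: "'i set \<Rightarrow> ('i \<Rightarrow> 'i \<Rightarrow> bool) \<Rightarrow> bool" where
  "directed_set A le \<longleftrightarrow> A \<noteq> {} \<and> reflp_on A le \<and> transp_on A le \<and>
    (\<forall>a\<in>A. \<forall>b\<in>A. \<exists>c\<in>A. le a c \<and> le b c)"

definition decreases_to_zero ::
    "'j set \<Rightarrow> ('j \<Rightarrow> 'j \<Rightarrow> bool) \<Rightarrow> ('j \<Rightarrow> 'f::riesz_space) \<Rightarrow> bool" where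
  "decreases_to_zero B le y \<longleftrightarrow> directed_set B le \<and> monotone_on B le (\<ge>) y \<and>
    (\<forall>b\<in>B. 0 \<le> y b) \<and> (\<forall>z. (\<forall>b\<in>B. z \<le> y b) \<longrightarrow> z \<le> 0)"

text \<open>HOL cannot quantify over the index type of the dominating net. Its index set is taken
  in the type \<open>'f\<close> itself; \<open>o_convergesI\<close> below shows that dominating nets over
  index sets of any other type give the same notion.\<close>

definition o_converges ::
    "'i set \<Rightarrow> ('i \<Rightarrow> 'i \<Rightarrow> bool) \<Rightarrow> ('i \<Rightarrow> 'f::riesz_space) \<Rightarrow> 'f \<Rightarrow> bool" where
  "o_converges A le x l \<longleftrightarrow>
    (\<exists>(B :: 'f set) leB y. decreases_to_zero B leB y \<and>
      (\<forall>b\<in>B. \<exists>a0\<in>A. \<forall>a\<in>A. le a0 a \<longrightarrow> \<bar>x a - l\<bar> \<le> y b))"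

definition mlo_converges ::
    "'i set \<Rightarrow> ('i \<Rightarrow> 'i \<Rightarrow> bool) \<Rightarrow> ('i \<Rightarrow> 'f::riesz_algebra) \<Rightarrow> 'f \<Rightarrow> bool" where
  "mlo_converges A le x l \<longleftrightarrow> (\<forall>u\<ge>0. o_converges A le (\<lambda>a. u * \<bar>x a - l\<bar>) 0)"

definition mro_converges ::
    "'i set \<Rightarrow> ('i \<Rightarrow> 'i \<Rightarrow> bool) \<Rightarrow> ('i \<Rightarrow> 'f::riesz_algebra) \<Rightarrow> 'f \<Rightarrow> bool" where
  "mro_converges A le x l \<longleftrightarrow> (\<forall>u\<ge>0. o_converges A le (\<lambda>a. \<bar>x a - l\<bar> * u) 0)"

definition mo_converges ::
    "'i set \<Rightarrow> ('i \<Rightarrow> 'i \<Rightarrow> bool) \<Rightarrow> ('i \<Rightarrow> 'f::riesz_algebra) \<Rightarrow> 'f \<Rightarrow> bool" where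
  "mo_converges A le x l \<longleftrightarrow> mlo_converges A le x l \<and> mro_converges A le x l"

text \<open>Here \<open>conv\<close> is one of the above modes of convergence; \<open>rel_prod le le\<close> is the
  componentwise preorder on \<open>A \<times> A\<close>.\<close>

definition Cauchy_net ::
    "(('i \<times> 'i) set \<Rightarrow> ('i \<times> 'i \<Rightarrow> 'i \<times> 'i \<Rightarrow> bool) \<Rightarrow> ('i \<times> 'i \<Rightarrow> 'f) \<Rightarrow> 'f \<Rightarrow> bool) \<Rightarrow>
      'i set \<Rightarrow> ('i \<Rightarrow> 'i \<Rightarrow> bool) \<Rightarrow> ('i \<Rightarrow> 'f::riesz_algebra) \<Rightarrow> bool" where
  "Cauchy_net conv A le y \<longleftrightarrow>
    conv (A \<times> A) (rel_prod le le) (\<lambda>(a1, a2). y a1 - y a2) 0"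


section \<open>Operators\<close>

definition positive_op :: "('x::riesz_space \<Rightarrow> 'f::riesz_space) \<Rightarrow> bool" where
  "positive_op T \<longleftrightarrow> linear T \<and> (\<forall>x\<ge>0. 0 \<le> T x)"

text \<open>This is the order on operators induced by the positive cone of the domain, not the
  pointwise order \<open>R \<le> Q\<close> on functions.\<close>

definition op_le ::
    "('x::riesz_space \<Rightarrow> 'f::riesz_space) \<Rightarrow> ('x \<Rightarrow> 'f) \<Rightarrow> bool" where
  "op_le R Q \<longleftrightarrow> positive_op (\<lambda>x. Q x - R x)"

definition bounded_increasing_net ::
    "'i set \<Rightarrow> ('i \<Rightarrow> 'i \<Rightarrow> bool) \<Rightarrow> ('i \<Rightarrow> 'x::locally_solid_riesz_space) \<Rightarrow> bool" where
  "bounded_increasing_net A le x \<longleftrightarrow> directed_set A le \<and> monotone_on A le (\<le>) x \<and>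
    (\<forall>a\<in>A. 0 \<le> x a) \<and> tau_bounded (x ` A)"

text \<open>The index sets of the increasing nets are taken in the type \<open>'x\<close>. This is no
  restriction: by \<open>quasi_mlo_KB_D\<close>, \<open>quasi_mro_KB_D\<close> and \<open>quasi_mo_KB_D\<close>
  below the Cauchy property then holds for nets over index sets of every type.\<close>

definition quasi_mlo_KB :: "('x::locally_solid_riesz_space \<Rightarrow> 'f::riesz_algebra) \<Rightarrow> bool" where
  "quasi_mlo_KB T \<longleftrightarrow> (\<forall>(A :: 'x set) le x. bounded_increasing_net A le x \<longrightarrow>
    Cauchy_net mlo_converges A le (\<lambda>a. T (x a)))"

definition quasi_mro_KB :: "('x::locally_solid_riesz_space \<Rightarrow> 'f::riesz_algebra) \<Rightarrow> bool" where
  "quasi_mro_KB T \<longleftrightarrow> (\<forall>(A :: 'x set) le x. bounded_increasing_net A le x \<longrightarrow>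
    Cauchy_net mro_converges A le (\<lambda>a. T (x a)))"

definition quasi_mo_KB :: "('x::locally_solid_riesz_space \<Rightarrow> 'f::riesz_algebra) \<Rightarrow> bool" where
  "quasi_mo_KB T \<longleftrightarrow> (\<forall>(A :: 'x set) le x. bounded_increasing_net A le x \<longrightarrow>
    Cauchy_net mo_converges A le (\<lambda>a. T (x a)))"


section \<open>Independence of the index types\<close>

lemma o_convergesI:
  fixes y :: "'j \<Rightarrow> 'f::riesz_space"
  assumes "decreases_to_zero B leB y"
    and "\<And>b. b \<in> B \<Longrightarrow> \<exists>a0\<in>A. \<forall>a\<in>A. le a0 a \<longrightarrow> \<bar>x a - l\<bar> \<le> y b"
  shows "o_converges A le x l"
proof -
  have "directed_set (y ` B) (\<ge>)"
    unfolding directed_set_def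
  proof (intro conjI ballI)
    show "y ` B \<noteq> {}" "reflp_on (y ` B) (\<ge>)" "transp_on (y ` B) (\<ge>)"
      using assms(1)
      by (auto simp: decreases_to_zero_def directed_set_def reflp_on_def transp_on_def)
    fix p q assume "p \<in> y ` B" "q \<in> y ` B"
    then obtain b c where bc: "b \<in> B" "c \<in> B" "p = y b" "q = y c" by blast
    then obtain d where "d \<in> B" "leB b d" "leB c d"
      using assms(1) unfolding decreases_to_zero_def directed_set_def by blast
    then show "\<exists>s\<in>y ` B. s \<le> p \<and> s \<le> q"
      using assms(1) bc unfolding decreases_to_zero_def monotone_on_def by blast
  qed
  then have "decreases_to_zero (y ` B) (\<ge>) (\<lambda>z. z)"
    using assms(1) unfolding decreases_to_zero_def by (auto simp: monotone_on_def)
  then show ?thesis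
    using assms(2) unfolding o_converges_def
    by (intro exI[of _ "y ` B"] exI[of _ "(\<ge>)"] exI[of _ "\<lambda>z. z"]) auto
qed

lemma o_converges_reindex:
  fixes g :: "'a \<Rightarrow> 'b::riesz_space"
  assumes "o_converges (h ` A) le' g l"
    and "\<And>a b. a \<in> A \<Longrightarrow> b \<in> A \<Longrightarrow> le a b \<Longrightarrow> le' (h a) (h b)"
  shows "o_converges A le (\<lambda>a. g (h a)) l"
proof -
  obtain B :: "'b set" and leB y where d: "decreases_to_zero B leB y"
    and t: "\<forall>b\<in>B. \<exists>a0\<in>h ` A. \<forall>a\<in>h ` A. le' a0 a \<longrightarrow> \<bar>g a - l\<bar> \<le> y b"
    using assms(1) unfolding o_converges_def by blast
  show ?thesis
  proof (rule o_convergesI[OF d])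
    fix b assume "b \<in> B"
    with t obtain a0 where "a0 \<in> A" "\<forall>a\<in>h ` A. le' (h a0) a \<longrightarrow> \<bar>g a - l\<bar> \<le> y b"
      by blast
    then show "\<exists>a0\<in>A. \<forall>a\<in>A. le a0 a \<longrightarrow> \<bar>g (h a) - l\<bar> \<le> y b"
      using assms(2) by blast
  qed
qed

lemma bounded_increasing_net_range:
  assumes "bounded_increasing_net A le x"
  shows "bounded_increasing_net (x ` A) (\<le>) (\<lambda>z. z)"
proof -
  have "\<exists>r\<in>x ` A. p \<le> r \<and> q \<le> r" if pq: "p \<in> x ` A" "q \<in> x ` A" for p q
  proof -
    obtain a b where ab: "a \<in> A" "b \<in> A" "p = x a" "q = x b"
      using pq by blast
    then obtain c where "c \<in> A" "le a c" "le b c"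
      using assms unfolding bounded_increasing_net_def directed_set_def by blast
    then show ?thesis
      using assms ab unfolding bounded_increasing_net_def monotone_on_def by blast
  qed
  moreover have "x ` A \<noteq> {}"
    using assms unfolding bounded_increasing_net_def directed_set_def by simp
  moreover have "reflp_on (x ` A) (\<le>)" "transp_on (x ` A) (\<le>)"
    by (auto intro: reflp_onI transp_onI order_trans)
  ultimately have "directed_set (x ` A) (\<le>)"
    unfolding directed_set_def by blast
  then show ?thesis
    using assms unfolding bounded_increasing_net_def by (simp add: monotone_on_def)
qed

lemma o_converges_range_net:
  fixes x :: "'i \<Rightarrow> 'x::locally_solid_riesz_space"
  assumes "bounded_increasing_net A le x"
    and "o_converges (x ` A \<times> x ` A) (rel_prod (\<le>) (\<le>)) g l"
  shows "o_converges (A \<times> A) (rel_prod le le) (\<lambda>p. g (map_prod x x p)) l"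
proof (rule o_converges_reindex[where h = "map_prod x x"])
  show "o_converges (map_prod x x ` (A \<times> A)) (rel_prod (\<le>) (\<le>)) g l"
    using assms(2) by (simp add: map_prod_surj_on[OF refl refl])
qed (use assms(1) in \<open>auto simp: bounded_increasing_net_def monotone_on_def\<close>)

lemma quasi_mlo_KB_D:
  fixes x :: "'i \<Rightarrow> 'x::locally_solid_riesz_space"
  assumes "quasi_mlo_KB T" "bounded_increasing_net A le x"
  shows "Cauchy_net mlo_converges A le (\<lambda>a. T (x a))"
proof -
  have "Cauchy_net mlo_converges (x ` A) (\<le>) T"
    using assms(1) bounded_increasing_net_range[OF assms(2)]
    unfolding quasi_mlo_KB_def by fast
  then have "o_converges (x ` A \<times> x ` A) (rel_prod (\<le>) (\<le>))
      (\<lambda>p. u * \<bar>(case p of (a1, a2) \<Rightarrow> T a1 - T a2) - 0\<bar>) 0" if "0 \<le> u" for u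
    using that unfolding Cauchy_net_def mlo_converges_def by blast
  from o_converges_range_net[OF assms(2) this] show ?thesis
    unfolding Cauchy_net_def mlo_converges_def by (simp add: case_prod_unfold)
qed

lemma quasi_mro_KB_D:
  fixes x :: "'i \<Rightarrow> 'x::locally_solid_riesz_space"
  assumes "quasi_mro_KB T" "bounded_increasing_net A le x"
  shows "Cauchy_net mro_converges A le (\<lambda>a. T (x a))"
proof -
  have "Cauchy_net mro_converges (x ` A) (\<le>) T"
    using assms(1) bounded_increasing_net_range[OF assms(2)]
    unfolding quasi_mro_KB_def by fast
  then have "o_converges (x ` A \<times> x ` A) (rel_prod (\<le>) (\<le>))
      (\<lambda>p. \<bar>(case p of (a1, a2) \<Rightarrow> T a1 - T a2) - 0\<bar> * u) 0" if "0 \<le> u" for u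
    using that unfolding Cauchy_net_def mro_converges_def by blast
  from o_converges_range_net[OF assms(2) this] show ?thesis
    unfolding Cauchy_net_def mro_converges_def by (simp add: case_prod_unfold)
qed

lemma quasi_mo_KB_D:
  fixes x :: "'i \<Rightarrow> 'x::locally_solid_riesz_space"
  assumes "quasi_mo_KB T" "bounded_increasing_net A le x"
  shows "Cauchy_net mo_converges A le (\<lambda>a. T (x a))"
proof -
  have "quasi_mlo_KB T" "quasi_mro_KB T"
    using assms(1)
    unfolding quasi_mo_KB_def quasi_mlo_KB_def quasi_mro_KB_def Cauchy_net_def mo_converges_def
    by blast+
  then show ?thesis
    using quasi_mlo_KB_D[OF _ assms(2)] quasi_mro_KB_D[OF _ assms(2)]
    unfolding Cauchy_net_def mo_converges_def by blast
qed

end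

theory Submission
  imports Defs
begin

text \<open>
  Let \<open>x\<close> be a bounded increasing net. Two tail terms \<open>x a\<close> and \<open>x b\<close> need not be comparable,
  so \<open>\<bar>S (x a) - S (x b)\<bar>\<close> need not be bounded by \<open>\<bar>T (x a) - T (x b)\<bar>\<close>. The index set being
  directed, however, both terms lie in an order interval \<open>[x d, x c]\<close> whose end points also belong
  to the tail. As \<open>S\<close> is positive, \<open>S (x a)\<close> and \<open>S (x b)\<close> lie in \<open>[S (x d), S (x c)]\<close>, and hence,
  as \<open>T - S\<close> is positive,
  \<open>\<bar>S (x a) - S (x b)\<bar> \<le> S (x c) - S (x d) \<le> T (x c) - T (x d)\<close>.
  Multiplication by a fixed \<open>u \<ge> 0\<close> on either side preserves this inequality, so every net that
  dominates the differences of \<open>T \<circ> x\<close> eventually dominates those of \<open>S \<circ> x\<close> as well, without an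
  additional factor.

  The lemma \<open>o_converges_differences_dominated\<close> carries this out for two nets \<open>s\<close> and \<open>t\<close> such
  that \<open>s\<close> is increasing with increments at most those of \<open>t\<close>; a monotone map \<open>\<phi>\<close> stands for the
  multiplication by \<open>u\<close>, so that it covers both sides at once.
\<close>

lemma abs_diff_le_interval_length:
  fixes p q l h :: "'f::riesz_space"
  assumes "l \<le> p" "p \<le> h" "l \<le> q" "q \<le> h"
  shows "\<bar>p - q\<bar> \<le> h - l"
proof (rule abs_leI)
  show "p - q \<le> h - l"
    using assms by (intro diff_mono)
  show "- (p - q) \<le> h - l"
    using diff_mono[OF assms(4,1)] by simp
qed

text \<open>If the increments of \<open>s\<close> are dominated by those of \<open>t\<close>, any two tail values of \<open>s\<close> are enclosed
  between values at comparable tail indices, which transfers the estimate from \<open>t\<close>.\<close>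

lemma o_converges_differences_dominated:
  fixes s t :: "'i \<Rightarrow> 'f::riesz_space" and \<phi> :: "'f \<Rightarrow> 'g::riesz_space"
  assumes dir: "directed_set A le"
    and s_mono: "monotone_on A le (\<le>) s"
    and incr: "\<And>a b. a \<in> A \<Longrightarrow> b \<in> A \<Longrightarrow> le a b \<Longrightarrow> s b - s a \<le> t b - t a"
    and \<phi>_nonneg: "\<And>z. 0 \<le> z \<Longrightarrow> 0 \<le> \<phi> z"
    and \<phi>_mono: "\<And>z w. 0 \<le> z \<Longrightarrow> z \<le> w \<Longrightarrow> \<phi> z \<le> \<phi> w"
    and conv: "o_converges (A \<times> A) (rel_prod le le) (\<lambda>(a, b). \<phi> \<bar>t a - t b\<bar>) 0"
  shows "o_converges (A \<times> A) (rel_prod le le) (\<lambda>(a, b). \<phi> \<bar>s a - s b\<bar>) 0"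
proof -
  have upper: "\<exists>c\<in>A. le a c \<and> le b c" if "a \<in> A" "b \<in> A" for a b
    using dir that unfolding directed_set_def by blast
  have trans: "le a c" if "le a b" "le b c" "a \<in> A" "b \<in> A" "c \<in> A" for a b c
    using dir that unfolding directed_set_def by (blast dest: transp_onD)
  have s_le: "s a \<le> s b" if "le a b" "a \<in> A" "b \<in> A" for a b
    using s_mono that unfolding monotone_on_def by blast
  obtain B :: "'g set" and leB y where dec: "decreases_to_zero B leB y"
    and dom: "\<And>i. i \<in> B \<Longrightarrow> \<exists>p0\<in>A \<times> A. \<forall>p\<in>A \<times> A. rel_prod le le p0 p \<longrightarrow>
      \<bar>(case p of (a, b) \<Rightarrow> \<phi> \<bar>t a - t b\<bar>) - 0\<bar> \<le> y i"
    using conv unfolding o_converges_def by blast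
  show ?thesis
  proof (rule o_convergesI[OF dec])
    fix i assume "i \<in> B"
    then obtain a0 b0 where a0: "a0 \<in> A" and b0: "b0 \<in> A"
      and t_small: "\<And>a b. a \<in> A \<Longrightarrow> b \<in> A \<Longrightarrow> le a0 a \<Longrightarrow> le b0 b \<Longrightarrow> \<bar>\<phi> \<bar>t a - t b\<bar>\<bar> \<le> y i"
      using dom by fastforce
    obtain d where d: "d \<in> A" "le a0 d" "le b0 d"
      using upper[OF a0 b0] by blast
    have s_small: "\<bar>\<phi> \<bar>s a - s b\<bar>\<bar> \<le> y i"
      if ab: "a \<in> A" "b \<in> A" "le d a" "le d b" for a b
    proof -
      obtain c where c: "c \<in> A" "le a c" "le b c"
        using upper[OF ab(1,2)] by blast
      have "le d c"
        using trans[OF ab(3) c(2)] d(1) ab(1) c(1) by blast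
      have "\<bar>s a - s b\<bar> \<le> s c - s d"
        using ab c d(1) by (intro abs_diff_le_interval_length s_le)
      also have "\<dots> \<le> t c - t d"
        using incr[OF d(1) c(1) \<open>le d c\<close>] .
      also have "\<dots> \<le> \<bar>t c - t d\<bar>"
        by (rule abs_ge_self)
      finally have "\<phi> \<bar>s a - s b\<bar> \<le> \<phi> \<bar>t c - t d\<bar>"
        by (intro \<phi>_mono) simp_all
      also have "\<dots> \<le> \<bar>\<phi> \<bar>t c - t d\<bar>\<bar>"
        by (rule abs_ge_self)
      also have "\<dots> \<le> y i"
        using t_small[OF c(1) d(1) trans[OF d(2) \<open>le d c\<close>] d(3)] a0 d(1) c(1) by blast
      finally show ?thesis
        by (simp add: abs_of_nonneg \<phi>_nonneg)
    qed
    then show "\<exists>p0\<in>A \<times> A. \<forall>p\<in>A \<times> A. rel_prod le le p0 p \<longrightarrow>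
        \<bar>(case p of (a, b) \<Rightarrow> \<phi> \<bar>s a - s b\<bar>) - 0\<bar> \<le> y i"
      using d(1) by (intro bexI[of _ "(d, d)"]) auto
  qed
qed

lemma Cauchy_net_mlo_dominated:
  fixes s t :: "'i \<Rightarrow> 'f::riesz_algebra"
  assumes "directed_set A le" "monotone_on A le (\<le>) s"
    and "\<And>a b. a \<in> A \<Longrightarrow> b \<in> A \<Longrightarrow> le a b \<Longrightarrow> s b - s a \<le> t b - t a"
    and "Cauchy_net mlo_converges A le t"
  shows "Cauchy_net mlo_converges A le s"
  using o_converges_differences_dominated[OF assms(1-3), where \<phi> = "\<lambda>z. u * z" for u] assms(4)
  unfolding Cauchy_net_def mlo_converges_def
  by (simp add: case_prod_unfold mult_pos_cone mult_left_mono)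

lemma Cauchy_net_mro_dominated:
  fixes s t :: "'i \<Rightarrow> 'f::riesz_algebra"
  assumes "directed_set A le" "monotone_on A le (\<le>) s"
    and "\<And>a b. a \<in> A \<Longrightarrow> b \<in> A \<Longrightarrow> le a b \<Longrightarrow> s b - s a \<le> t b - t a"
    and "Cauchy_net mro_converges A le t"
  shows "Cauchy_net mro_converges A le s"
  using o_converges_differences_dominated[OF assms(1-3), where \<phi> = "\<lambda>z. z * u" for u] assms(4)
  unfolding Cauchy_net_def mro_converges_def
  by (simp add: case_prod_unfold mult_pos_cone mult_right_mono)

lemma Cauchy_net_mo_iff:
  "Cauchy_net mo_converges A le y \<longleftrightarrow>
    Cauchy_net mlo_converges A le y \<and> Cauchy_net mro_converges A le y"
  unfolding Cauchy_net_def mo_converges_def ..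

lemma positive_op_mono:
  assumes "positive_op R" "x \<le> y"
  shows "R x \<le> R y"
proof -
  have "0 \<le> R (y - x)"
    using assms by (simp add: positive_op_def)
  then show ?thesis
    using assms(1) by (simp add: positive_op_def linear_diff)
qed

theorem theorem3p5:
  fixes S T :: "'x::locally_solid_riesz_space \<Rightarrow> 'f::riesz_algebra"
  assumes "linear T" and "positive_op T"
    and "linear S" and "op_le (\<lambda>_. 0) S" and "op_le S T"
  shows "(quasi_mo_KB T \<longrightarrow> quasi_mo_KB S) \<and>
    (quasi_mlo_KB T \<longrightarrow> quasi_mlo_KB S) \<and>
    (quasi_mro_KB T \<longrightarrow> quasi_mro_KB S)"
proof -
  have S_mono: "S p \<le> S q" if "p \<le> q" for p q
    using assms(4) that unfolding op_le_def by (simp add: positive_op_mono)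
  have incr: "S q - S p \<le> T q - T p" if "p \<le> q" for p q
    using positive_op_mono[OF assms(5)[unfolded op_le_def] that] by (simp add: algebra_simps)
  have net: "directed_set A le" "monotone_on A le (\<le>) (\<lambda>a. S (x a))"
    "\<And>a b. a \<in> A \<Longrightarrow> b \<in> A \<Longrightarrow> le a b \<Longrightarrow> S (x b) - S (x a) \<le> T (x b) - T (x a)"
    if "bounded_increasing_net A le x" for A :: "'x set" and le x
    using that S_mono incr unfolding bounded_increasing_net_def monotone_on_def by blast+
  have mlo: "Cauchy_net mlo_converges A le (\<lambda>a. S (x a))"
    if "bounded_increasing_net A le x" "Cauchy_net mlo_converges A le (\<lambda>a. T (x a))"
    for A :: "'x set" and le x
    using Cauchy_net_mlo_dominated[OF net[OF that(1)] that(2)] .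
  have mro: "Cauchy_net mro_converges A le (\<lambda>a. S (x a))"
    if "bounded_increasing_net A le x" "Cauchy_net mro_converges A le (\<lambda>a. T (x a))"
    for A :: "'x set" and le x
    using Cauchy_net_mro_dominated[OF net[OF that(1)] that(2)] .
  show ?thesis
    unfolding quasi_mo_KB_def quasi_mlo_KB_def quasi_mro_KB_def Cauchy_net_mo_iff
    using mlo mro by blast
qed

end
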